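(* Let $G$ be a finite simple graph and let $M=\{e_i=u_iv_i : 1\le i\le s\}$ be a matching without common neighbors of $G$. Then $$d(M)=k+\sum_{i=1}^{s}\bigl(d(u_i)d(v_i)-|N(u_i)\cap N(v_i)|\bigr),$$ where $k\ge 0$ is the number of edges of $G$ that are incident to none of the vertices $u_1,\dots,u_s,v_1,\dots,v_s$.
   Context: A matching of $G=(V,E)$ is a set of pairwise disjoint edges. For an edge $e$, $I(e)$ is the set of edges of $G$ other than $e$ sharing a vertex with $e$. A matching $M$ is without common neighbors if $I(e)\cap I(f)=\emptyset$ for all distinct $e,f\in M$. $d(v)$ and $N(v)$ denote the degree and neighborhood of a vertex $v$ in $G$. The matching polytope $\mathcal{M}(G)$ is the convex hull of the incidence vectors $\chi_M\in\mathbb{R}^E$ of all matchings $M$ of $G$ (these are exactly its vertices); the skeleton $\mathcal{G}(\mathcal{M}(G))$ is the graph of vertices and edges (1-dimensional faces) of $\mathcal{M}(G)$, and $d(M)$ is the degree of $\chi_M$ in the skeleton. *)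

theory Defs
  imports "HOL-Analysis.Analysis"
begin

definition simple_graph :: "'a set \<Rightarrow> 'a set set \<Rightarrow> bool" where
  "simple_graph V E \<longleftrightarrow> finite V \<and> (\<forall>e\<in>E. e \<subseteq> V \<and> card e = 2)"

definition neighborhood :: "'a set set \<Rightarrow> 'a \<Rightarrow> 'a set" where
  "neighborhood E v = {w. {v, w} \<in> E}"

definition vdegree :: "'a set set \<Rightarrow> 'a \<Rightarrow> nat" where
  "vdegree E v = card {e \<in> E. v \<in> e}"

definition matching :: "'a set set \<Rightarrow> 'a set set \<Rightarrow> bool" where
  "matching E M \<longleftrightarrow> M \<subseteq> E \<and> pairwise disjnt M"

definition incident_edges :: "'a set set \<Rightarrow> 'a set \<Rightarrow> 'a set set" where
  "incident_edges E e = {f \<in> E. f \<noteq> e \<and> f \<inter> e \<noteq> {}}"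

definition matching_without_common_neighbors :: "'a set set \<Rightarrow> 'a set set \<Rightarrow> bool" where
  "matching_without_common_neighbors E M \<longleftrightarrow> matching E M \<and>
     (\<forall>e\<in>M. \<forall>f\<in>M. e \<noteq> f \<longrightarrow> incident_edges E e \<inter> incident_edges E f = {})"

text \<open>The space \<open>\<real>\<^sup>E\<close> is identified with the coordinate subspace of \<open>real ^ 'a set\<close>
  (one coordinate for every set of vertices) in which all coordinates outside \<open>E\<close> vanish.
  Convex hulls, faces and their dimensions do not depend on this embedding.\<close>

definition incidence_vector :: "'a::finite set set \<Rightarrow> real ^ 'a set" where
  "incidence_vector M = (\<chi> e. if e \<in> M then 1 else 0)"

definition matching_polytope :: "'a::finite set set \<Rightarrow> (real ^ 'a set) set" where
  "matching_polytope E = convex hull (incidence_vector ` {M. matching E M})"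

text \<open>The edge set of the skeleton of a polytope: each one-dimensional face is represented by
  the pair of its end points, so that the skeleton is again a graph with edges of the form
  \<open>{x, y}\<close>.\<close>

definition skeleton_edges :: "'b::euclidean_space set \<Rightarrow> 'b set set" where
  "skeleton_edges P = {{x, y} | x y. x extreme_point_of P \<and> y extreme_point_of P \<and> x \<noteq> y \<and>
     closed_segment x y edge_of P}"

definition matching_degree :: "'a::finite set set \<Rightarrow> 'a set set \<Rightarrow> nat" where
  "matching_degree E M = vdegree (skeleton_edges (matching_polytope E)) (incidence_vector M)"

end

theory Submission
  imports Defs
begin

text \<open>
  Two matchings \<open>M\<close> and \<open>N\<close> are adjacent in the skeleton iff their symmetric difference cannot be
  split into two nonempty parts each of which may be swapped on its own (Chvatal's criterion): a
  splitting exhibits the midpoint of \<open>M\<close> and \<open>N\<close> as the midpoint of two other vertices, and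
  otherwise the segment is cut out by the valid equations \<open>x\<^sub>e = 1\<close> on \<open>M \<inter> N\<close>,
  \<open>x\<^sub>e = 0\<close> outside \<open>M \<union> N\<close> and \<open>x\<^sub>e + x\<^sub>f = 1\<close> for incident \<open>e \<in> M - N\<close>, \<open>f \<in> N - M\<close>.
  If \<open>M\<close> is without common neighbors, an unsplittable difference is either a single edge avoiding
  \<open>M\<close>, or one edge \<open>uv\<close> of \<open>M\<close> together with a matching of edges incident to \<open>uv\<close>. The latter
  matchings correspond to pairs of an edge at \<open>u\<close> and an edge at \<open>v\<close>, where \<open>uv\<close> itself stands for
  ``no edge'' and the pairs meeting in a common neighbor of \<open>u\<close> and \<open>v\<close> are excluded.
\<close>

section \<open>Incidence vectors, partial exchanges and matchings\<close>

lemma incidence_vector_inject: "incidence_vector M = incidence_vector N \<longleftrightarrow> M = N"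
  by (auto simp: incidence_vector_def vec_eq_iff split: if_splits)

text \<open>\<open>M \<inter> N \<union> (M \<union> N - X)\<close> is the result of applying to \<open>M\<close> the part of the exchange from \<open>M\<close>
  to \<open>N\<close> that is not applied in \<open>X\<close>.\<close>

definition swap_prime :: "'a set set \<Rightarrow> 'a set set \<Rightarrow> 'a set set \<Rightarrow> bool" where
  "swap_prime E M N \<longleftrightarrow> (\<forall>X. matching E X \<and> M \<inter> N \<subseteq> X \<and> X \<subseteq> M \<union> N \<and>
     matching E (M \<inter> N \<union> (M \<union> N - X)) \<longrightarrow> X = M \<or> X = N)"

lemma matching_disjoint: "matching E M \<Longrightarrow> e \<in> M \<Longrightarrow> f \<in> M \<Longrightarrow> e \<inter> f \<noteq> {} \<Longrightarrow> e = f"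
  unfolding matching_def pairwise_def disjnt_def by blast

lemma matchingI:
  assumes "M \<subseteq> E" "\<And>e f. e \<in> M \<Longrightarrow> f \<in> M \<Longrightarrow> e \<inter> f \<noteq> {} \<Longrightarrow> e = f"
  shows "matching E M"
  using assms unfolding matching_def pairwise_def disjnt_def by blast

lemma matching_subset: "matching E M \<Longrightarrow> N \<subseteq> M \<Longrightarrow> matching E N"
  unfolding matching_def by (meson pairwise_subset subset_trans)

section \<open>Adjacency of matchings in the skeleton\<close>

text \<open>The functional \<open>c\<close> adds up valid inequalities that are tight at both
  \<open>M\<close> and \<open>N\<close>. Primality of the exchange leaves no third vertex at which
  all of them are tight, so \<open>c \<bullet> x = b\<close> cuts out exactly the segment.\<close>

lemma segment_face_if_swap_prime:
  fixes E M N :: "'a::finite set set"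
  assumes M: "matching E M" and N: "matching E N" and sp: "swap_prime E M N"
  shows "closed_segment (incidence_vector M) (incidence_vector N) face_of matching_polytope E"
proof -
  define Q where "Q = {(e, f). e \<in> M - N \<and> f \<in> N - M \<and> e \<inter> f \<noteq> {}}"
  define c :: "real ^ 'a set" where
    "c = (\<Sum>e\<in>M \<inter> N. axis e 1) - (\<Sum>e\<in>- (M \<union> N). axis e 1)
       + (\<Sum>p\<in>Q. axis (fst p) 1 + axis (snd p) 1)"
  define b where "b = real (card (M \<inter> N)) + real (card Q)"
  define i where "i X e = (if e \<in> X then 1 else 0 :: real)" for X and e :: "'a set"
  \<comment> \<open>The gaps of the inequalities x_e \<le> 1 on common edges, x_e \<ge> 0 outside
    the union and x_e + x_f \<le> 1 on the conflicting pairs in \<open>Q\<close>.\<close>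
  define slack where "slack X = (\<Sum>e\<in>M \<inter> N. 1 - i X e) + (\<Sum>e\<in>- (M \<union> N). i X e)
       + (\<Sum>p\<in>Q. 1 - (i X (fst p) + i X (snd p)))" for X
  have slack: "c \<bullet> incidence_vector X = b - slack X" for X
    unfolding c_def b_def slack_def
    by (simp add: inner_add_left inner_diff_left inner_sum_left inner_axis' incidence_vector_def
        i_def[symmetric] sum_subtractf sum.distrib)
  have Q_le: "i X (fst p) + i X (snd p) \<le> 1" if "matching E X" "p \<in> Q" for X p
  proof -
    have "\<not> (fst p \<in> X \<and> snd p \<in> X)"
      using that(2) matching_disjoint[OF that(1), of "fst p" "snd p"] unfolding Q_def by fastforce
    then show ?thesis by (simp add: i_def)
  qed
  have parts_nonneg: "(\<Sum>e\<in>M \<inter> N. 1 - i X e) \<ge> 0" "(\<Sum>e\<in>- (M \<union> N). i X e) \<ge> 0"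
      "(\<Sum>p\<in>Q. 1 - (i X (fst p) + i X (snd p))) \<ge> 0" if "matching E X" for X
    using Q_le[OF that] by (auto intro!: sum_nonneg simp: i_def)
  have slack_nonneg: "slack X \<ge> 0" if "matching E X" for X
    using parts_nonneg[OF that] by (simp add: slack_def)
  have slack_zero: "X = M \<or> X = N" if X: "matching E X" and "slack X = 0" for X
  proof -
    have z: "(\<Sum>e\<in>M \<inter> N. 1 - i X e) = 0" "(\<Sum>e\<in>- (M \<union> N). i X e) = 0"
      "(\<Sum>p\<in>Q. 1 - (i X (fst p) + i X (snd p))) = 0"
      using parts_nonneg[OF X] \<open>slack X = 0\<close> unfolding slack_def by linarith+
    have "\<forall>e\<in>M \<inter> N. 1 - i X e = 0"
      using z(1) by (subst (asm) sum_nonneg_eq_0_iff) (auto simp: i_def)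
    then have lo: "M \<inter> N \<subseteq> X" by (auto simp: i_def split: if_splits)
    have "\<forall>e\<in>- (M \<union> N). i X e = 0"
      using z(2) by (subst (asm) sum_nonneg_eq_0_iff) (auto simp: i_def)
    then have up: "X \<subseteq> M \<union> N" by (auto simp: i_def split: if_splits)
    have "\<forall>p\<in>Q. 1 - (i X (fst p) + i X (snd p)) = 0"
      using z(3) Q_le[OF X] by (subst (asm) sum_nonneg_eq_0_iff) auto
    then have cover: "e \<in> X \<or> f \<in> X" if "(e, f) \<in> Q" for e f
      using that by (fastforce simp: i_def dest: bspec[of _ _ "(e, f)"] split: if_splits)
    \<comment> \<open>Since \<open>cover\<close> puts a member of each pair of \<open>Q\<close> into
      \<open>X\<close>, two meeting edges of the complementary exchange never form such a pair;
      hence both lie in \<open>M\<close> or both in \<open>N\<close>.\<close>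
    have "matching E (M \<inter> N \<union> (M \<union> N - X))"
    proof (rule matchingI)
      show "M \<inter> N \<union> (M \<union> N - X) \<subseteq> E" using M N by (auto simp: matching_def)
    next
      fix e f assume ef: "e \<in> M \<inter> N \<union> (M \<union> N - X)" "f \<in> M \<inter> N \<union> (M \<union> N - X)" "e \<inter> f \<noteq> {}"
      have "(e, f) \<notin> Q" "(f, e) \<notin> Q" using cover ef(1,2) by (auto simp: Q_def)
      then have "e \<in> M \<and> f \<in> M \<or> e \<in> N \<and> f \<in> N" using ef by (auto simp: Q_def)
      then show "e = f" using matching_disjoint[OF M, of e f] matching_disjoint[OF N, of e f] ef(3)
        by blast
    qed
    then show ?thesis using sp X lo up unfolding swap_prime_def by blast
  qed
  have slack_MN: "slack M = 0" "slack N = 0"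
    unfolding slack_def by (auto simp: i_def Q_def intro!: sum.neutral)
  let ?S = "incidence_vector ` {X. matching E X}"
  define T where "T = matching_polytope E \<inter> {x. c \<bullet> x = b}"
  have "convex hull ?S \<subseteq> {x. c \<bullet> x \<le> b}"
    by (rule hull_minimal) (auto simp: slack slack_nonneg convex_halfspace_le)
  then have T_face: "T face_of matching_polytope E"
    unfolding T_def matching_polytope_def
    by (intro face_of_Int_supporting_hyperplane_le convex_convex_hull) auto
  \<comment> \<open>A face of a polytope is the hull of some of its generators, and zero slack
    leaves only the two end points.\<close>
  then obtain S' where S': "S' \<subseteq> ?S" "T = convex hull S'"
    using face_of_convex_hull_subset[of ?S T]
    by (auto simp: matching_polytope_def finite_imp_compact)
  have "S' \<subseteq> T" using S'(2) hull_subset by metis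
  then have "S' \<subseteq> {incidence_vector M, incidence_vector N}"
    using S'(1) slack_zero by (fastforce simp: T_def slack)
  then have "T \<subseteq> closed_segment (incidence_vector M) (incidence_vector N)"
    unfolding S'(2) segment_convex_hull by (rule hull_mono)
  moreover have "incidence_vector M \<in> T" "incidence_vector N \<in> T"
    using M N slack_MN by (auto simp: T_def slack matching_polytope_def intro!: hull_inc)
  then have "closed_segment (incidence_vector M) (incidence_vector N) \<subseteq> T"
    by (intro closed_segment_subset) (auto simp: S'(2))
  ultimately show ?thesis using T_face by simp
qed

text \<open>All coordinates are 0 or 1, so one at which \<open>M\<close> and \<open>N\<close> differ
  forces the parameter \<open>t\<close> to be 0 or 1.\<close>

lemma incidence_vector_in_segment:
  assumes "incidence_vector X \<in> closed_segment (incidence_vector M) (incidence_vector N)"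
  shows "X = M \<or> X = N"
proof -
  from assms obtain t where t: "0 \<le> t" "t \<le> 1"
    and "incidence_vector X = (1 - t) *\<^sub>R incidence_vector M + t *\<^sub>R incidence_vector N"
    by (auto simp: closed_segment_def)
  then have eq: "(if e \<in> X then 1 else 0) =
      (1 - t) * (if e \<in> M then 1 else 0) + t * (if e \<in> N then 1 else 0)" for e
    by (simp add: vec_eq_iff incidence_vector_def)
  show ?thesis
  proof (cases "M = N")
    case True
    then have "e \<in> X \<longleftrightarrow> e \<in> M" for e using eq[of e] by (simp split: if_splits)
    then show ?thesis by blast
  next
    case False
    then obtain e where "(e \<in> M) \<noteq> (e \<in> N)" by auto
    then have "t = 0 \<or> t = 1" using eq[of e] by (auto split: if_splits)
    then show ?thesis
    proof
      assume "t = 0"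
      then have "e \<in> X \<longleftrightarrow> e \<in> M" for e using eq[of e] by (simp split: if_splits)
      then show ?thesis by blast
    next
      assume "t = 1"
      then have "e \<in> X \<longleftrightarrow> e \<in> N" for e using eq[of e] by (simp split: if_splits)
      then show ?thesis by blast
    qed
  qed
qed

text \<open>A partial exchange \<open>X\<close> and its complement have the same midpoint as
  \<open>M\<close> and \<open>N\<close>. A face containing that midpoint contains both, and the
  segment carries no further incidence vectors.\<close>

lemma swap_prime_if_segment_face:
  fixes E M N :: "'a::finite set set"
  assumes F: "closed_segment (incidence_vector M) (incidence_vector N) face_of matching_polytope E"
  shows "swap_prime E M N"
  unfolding swap_prime_def
proof (intro allI impI, elim conjE)
  fix X assume X: "matching E X" "M \<inter> N \<subseteq> X" "X \<subseteq> M \<union> N"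
  let ?Y = "M \<inter> N \<union> (M \<union> N - X)"
  assume Y: "matching E ?Y"
  have P: "incidence_vector X \<in> matching_polytope E" "incidence_vector ?Y \<in> matching_polytope E"
    using X(1) Y by (auto simp: matching_polytope_def intro!: hull_inc)
  have "incidence_vector X + incidence_vector ?Y = incidence_vector M + incidence_vector N"
    using X(2,3) by (auto simp: vec_eq_iff incidence_vector_def)
  then have mid: "midpoint (incidence_vector X) (incidence_vector ?Y) =
      midpoint (incidence_vector M) (incidence_vector N)"
    by (simp add: midpoint_def)
  show "X = M \<or> X = N"
  proof (cases "X = ?Y")
    case True
    then have "M = N" "X = M" using X(2,3) by auto
    then show ?thesis by simp
  next
    case False
    then have "midpoint (incidence_vector X) (incidence_vector ?Y) \<in>
        open_segment (incidence_vector X) (incidence_vector ?Y)"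
      by (simp add: incidence_vector_inject)
    moreover have "midpoint (incidence_vector X) (incidence_vector ?Y) \<in>
        closed_segment (incidence_vector M) (incidence_vector N)"
      unfolding mid by simp
    ultimately have "incidence_vector X \<in> closed_segment (incidence_vector M) (incidence_vector N)"
      using F P unfolding face_of_def by blast
    then show ?thesis by (rule incidence_vector_in_segment)
  qed
qed

text \<open>This turns geometry into counting: a skeleton edge at the vertex of \<open>M\<close> is
  determined by its other end point, and the two preceding criteria say which end points
  occur.\<close>

lemma matching_degree_eq_card:
  fixes E M :: "'a::finite set set"
  assumes M: "matching E M"
  shows "matching_degree E M = card {N. matching E N \<and> N \<noteq> M \<and> swap_prime E M N}"
proof -
  let ?i = "incidence_vector :: 'a set set \<Rightarrow> _"
  let ?P = "matching_polytope E"
  let ?A = "{N. matching E N \<and> N \<noteq> M \<and> swap_prime E M N}"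
  have "{e \<in> skeleton_edges ?P. ?i M \<in> e} = (\<lambda>N. {?i M, ?i N}) ` ?A"
  proof (intro equalityI subsetI)
    fix e assume "e \<in> {e \<in> skeleton_edges ?P. ?i M \<in> e}"
    then obtain y where y: "e = {?i M, y}" "y extreme_point_of ?P" "y \<noteq> ?i M"
        "closed_segment (?i M) y edge_of ?P"
      by (auto simp: skeleton_edges_def closed_segment_commute doubleton_eq_iff)
    then obtain N where N: "matching E N" "y = ?i N"
      using extreme_point_of_convex_hull by (fastforce simp: matching_polytope_def)
    then show "e \<in> (\<lambda>N. {?i M, ?i N}) ` ?A"
      using y swap_prime_if_segment_face[of M N E] by (auto simp: edge_of_def)
  next
    fix e assume "e \<in> (\<lambda>N. {?i M, ?i N}) ` ?A"
    then obtain N where N: "e = {?i M, ?i N}" "matching E N" "N \<noteq> M" "swap_prime E M N" by blast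
    have F: "closed_segment (?i M) (?i N) face_of ?P"
      using segment_face_if_swap_prime M N by blast
    have "?i M extreme_point_of ?P" "?i N extreme_point_of ?P"
      using extreme_point_of_face[OF F] by (auto simp: extreme_point_of_segment)
    moreover have "closed_segment (?i M) (?i N) edge_of ?P"
      using F N(3) by (simp add: edge_of_def segment_convex_hull
          aff_dim_convex_hull aff_dim_2 incidence_vector_inject)
    moreover have "?i M \<noteq> ?i N" using N(3) by (simp add: incidence_vector_inject)
    ultimately show "e \<in> {e \<in> skeleton_edges ?P. ?i M \<in> e}"
      unfolding skeleton_edges_def N(1) by blast
  qed
  moreover have "inj_on (\<lambda>N. {?i M, ?i N}) ?A"
    by (auto simp: inj_on_def doubleton_eq_iff incidence_vector_inject)
  ultimately show ?thesis
    by (simp add: matching_degree_def vdegree_def card_image)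
qed

section \<open>Exchanges from a matching without common neighbors\<close>

text \<open>The edge \<open>f\<close> is outside \<open>M\<close> because \<open>e\<close> already
  covers one of its vertices. If it also met another edge of \<open>M\<close>, the two would have
  \<open>f\<close> as a common neighbor.\<close>

lemma incident_edge_meets_one:
  assumes "matching_without_common_neighbors E M" "e \<in> M" "e' \<in> M"
    and "f \<in> incident_edges E e" "f \<inter> e' \<noteq> {}"
  shows "e' = e \<and> f \<notin> M"
proof -
  have M: "matching E M" using assms(1) by (simp add: matching_without_common_neighbors_def)
  have "f \<notin> M" using matching_disjoint[OF M, of f e] assms(2,4) by (auto simp: incident_edges_def)
  moreover from this have "f \<in> incident_edges E e'"
    using assms by (auto simp: incident_edges_def)
  ultimately show ?thesis
    using assms unfolding matching_without_common_neighbors_def by blast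
qed

text \<open>Exchanges around different edges of \<open>M\<close> do not interact, so a prime one
  either adds a single edge away from \<open>M\<close> or replaces one \<open>e\<close> by a
  matching of edges incident to it. The empty replacement is included and deletes
  \<open>e\<close>.\<close>

lemma swap_prime_neighbors_eq:
  assumes ncn: "matching_without_common_neighbors E M" and ne: "{} \<notin> E"
  shows "{N. matching E N \<and> N \<noteq> M \<and> swap_prime E M N} =
    (\<lambda>g. insert g M) ` {g \<in> E. g \<inter> \<Union>M = {}} \<union>
    (\<Union>e\<in>M. (\<lambda>F. (M - {e}) \<union> F) ` {F. matching E F \<and> F \<subseteq> incident_edges E e})"
  (is "?L = ?A \<union> ?B")
proof (intro equalityI subsetI)
  have M: "matching E M" using ncn by (simp add: matching_without_common_neighbors_def)
  note one = incident_edge_meets_one[OF ncn]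
  fix N assume "N \<in> ?L"
  then have N: "matching E N" "N \<noteq> M"
    and prime: "\<And>X. matching E X \<Longrightarrow> M \<inter> N \<subseteq> X \<Longrightarrow> X \<subseteq> M \<union> N \<Longrightarrow>
        matching E (M \<inter> N \<union> (M \<union> N - X)) \<Longrightarrow> X = M \<or> X = N"
    unfolding swap_prime_def by blast+
  show "N \<in> ?A \<union> ?B"
  proof (cases "M \<subseteq> N")
    case True
    then obtain g where g: "g \<in> N" "g \<notin> M" using N(2) by blast
    \<comment> \<open>Adding only \<open>g\<close> is a partial exchange with complement
      \<open>N - {g}\<close>; both are matchings as subsets of \<open>N\<close>.\<close>
    have "insert g M = M \<or> insert g M = N"
      using g True by (intro prime matching_subset[OF N(1)]) auto
    then have "N = insert g M" using g by blast
    moreover have "g \<in> E" using g N(1) by (auto simp: matching_def)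
    moreover have "g \<inter> \<Union>M = {}"
      using g True matching_disjoint[OF N(1), of g] by blast
    ultimately show ?thesis by blast
  next
    case False
    then obtain e where e: "e \<in> M" "e \<notin> N" by blast
    \<comment> \<open>The new edges that block \<open>e\<close>. Trading \<open>e\<close> for
      \<open>F\<close> is the partial exchange tested against primality.\<close>
    define F where "F = {f \<in> N - M. f \<inter> e \<noteq> {}}"
    have F: "F \<subseteq> incident_edges E e"
      using N(1) e by (auto simp: F_def incident_edges_def matching_def)
    have F': "matching E F" by (rule matching_subset[OF N(1)]) (auto simp: F_def)
    have "M - {e} \<union> F = M \<or> M - {e} \<union> F = N"
    proof (rule prime)
      show "matching E (M - {e} \<union> F)"
      proof (rule matchingI)
        show "M - {e} \<union> F \<subseteq> E" using M F' by (auto simp: matching_def)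
      next
        fix a b assume "a \<in> M - {e} \<union> F" "b \<in> M - {e} \<union> F" "a \<inter> b \<noteq> {}"
        then show "a = b"
          using matching_disjoint[OF M, of a b] matching_disjoint[OF F', of a b]
            one[OF e(1), of a b] one[OF e(1), of b a] F by blast
      qed
      show "matching E (M \<inter> N \<union> (M \<union> N - (M - {e} \<union> F)))"
      proof (rule matchingI)
        show "M \<inter> N \<union> (M \<union> N - (M - {e} \<union> F)) \<subseteq> E" using M N by (auto simp: matching_def)
      next
        fix a b assume ab: "a \<in> M \<inter> N \<union> (M \<union> N - (M - {e} \<union> F))"
          "b \<in> M \<inter> N \<union> (M \<union> N - (M - {e} \<union> F))" "a \<inter> b \<noteq> {}"
        \<comment> \<open>Besides edges of \<open>N\<close> the complementary exchange contains only
          \<open>e\<close>, and the new edges remaining in it avoid \<open>e\<close>.\<close>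
        have "a \<in> M \<and> b \<in> M \<or> a \<in> N \<and> b \<in> N"
          using ab by (auto simp: F_def)
        then show "a = b"
          using matching_disjoint[OF M, of a b] matching_disjoint[OF N(1), of a b] ab(3) by blast
      qed
    qed (use e in \<open>auto simp: F_def\<close>)
    then have "N = M - {e} \<union> F" using e by (auto simp: F_def)
    then show ?thesis using e F F' by blast
  qed
next
  have M: "matching E M" using ncn by (simp add: matching_without_common_neighbors_def)
  note one = incident_edge_meets_one[OF ncn]
  fix N assume "N \<in> ?A \<union> ?B"
  then show "N \<in> ?L"
  proof
    assume "N \<in> ?A"
    then obtain g where g: "N = insert g M" "g \<in> E" "g \<inter> \<Union>M = {}" by blast
    have "g \<notin> M"
    proof
      assume "g \<in> M"
      then have "g = {}" using g(3) by auto
      then show False using g(2) ne by simp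
    qed
    moreover have "matching E N"
    proof (rule matchingI)
      show "N \<subseteq> E" using g M by (auto simp: matching_def)
    next
      fix a b assume "a \<in> N" "b \<in> N" "a \<inter> b \<noteq> {}"
      then show "a = b" using g matching_disjoint[OF M, of a b] by auto
    qed
    moreover have "swap_prime E M N" unfolding swap_prime_def g(1) by blast
    ultimately show ?thesis using g(1) by auto
  next
    assume "N \<in> ?B"
    then obtain e F where e: "e \<in> M" and F: "matching E F" "F \<subseteq> incident_edges E e"
      and N: "N = M - {e} \<union> F" by blast
    have meets: "f \<inter> e \<noteq> {}" if "f \<in> F" for f using that F by (auto simp: incident_edges_def)
    have FM: "f \<notin> M" if "f \<in> F" for f using one[OF e e, of f] meets[OF that] that F by blast
    have "matching E N"
    proof (rule matchingI)
      show "N \<subseteq> E" using M F by (auto simp: matching_def N)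
    next
      fix a b assume "a \<in> N" "b \<in> N" "a \<inter> b \<noteq> {}"
      then show "a = b"
        using matching_disjoint[OF M, of a b] matching_disjoint[OF F(1), of a b]
          one[OF e, of a b] one[OF e, of b a] F unfolding N by blast
    qed
    moreover have "N \<noteq> M" using e FM by (auto simp: N)
    moreover have "swap_prime E M N"
      unfolding swap_prime_def
    proof (intro allI impI, elim conjE)
      fix X assume X: "matching E X" "M \<inter> N \<subseteq> X" "X \<subseteq> M \<union> N" "matching E (M \<inter> N \<union> (M \<union> N - X))"
      show "X = M \<or> X = N"
      \<comment> \<open>Every edge of \<open>F\<close> conflicts with \<open>e\<close>: if
        \<open>X\<close> keeps \<open>e\<close> it takes nothing from \<open>F\<close>; otherwise
        the complement keeps \<open>e\<close>, so \<open>X\<close> must take all of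
        \<open>F\<close>.\<close>
      proof (cases "e \<in> X")
        case True
        have "f \<notin> X" if "f \<in> F" for f
          using matching_disjoint[OF X(1) _ True, of f] meets[OF that] FM[OF that] e by blast
        then have "X = M" using X(2,3) True e by (auto simp: N)
        then show ?thesis ..
      next
        case False
        have "f \<in> X" if "f \<in> F" for f
          using matching_disjoint[OF X(4), of f e] False meets[OF that] FM[OF that] e that
          by (auto simp: N)
        then have "X = N" using X(2,3) False e by (auto simp: N)
        then show ?thesis ..
      qed
    qed
    ultimately show ?thesis by blast
  qed
qed

section \<open>Matchings among the edges incident to a given edge\<close>

lemma simple_graph_edge_eq:
  assumes "simple_graph V E" "f \<in> E" "x \<in> f" "y \<in> f" "x \<noteq> y"
  shows "f = {x, y}"
proof -
  have "card f = 2" using assms by (simp add: simple_graph_def)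
  then show ?thesis using assms(3-5) by (auto simp: card_2_iff)
qed

text \<open>Such a matching has at most one edge at \<open>a\<close> and at most one at
  \<open>b\<close>. With \<open>{a, b}\<close> standing for an absent edge it becomes a pair in the
  product of the two stars; the only pairs that fail are those whose edges meet in a common
  neighbor.\<close>

lemma card_incident_matchings:
  fixes V :: "'a set"
  assumes G: "simple_graph V E" and e: "{a, b} \<in> E"
  shows "int (card {F. matching E F \<and> F \<subseteq> incident_edges E {a, b}}) =
    int (vdegree E a) * int (vdegree E b) - int (card (neighborhood E a \<inter> neighborhood E b))"
proof -
  let ?D = "\<lambda>x. {f \<in> E. x \<in> f}"
  let ?C = "neighborhood E a \<inter> neighborhood E b"
  let ?T = "(\<lambda>x. ({a, x}, {b, x})) ` ?C"
  let ?F = "{F. matching E F \<and> F \<subseteq> incident_edges E {a, b}}"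
  note edge = simple_graph_edge_eq[OF G]
  have card2: "card f = 2" if "f \<in> E" for f using G that by (simp add: simple_graph_def)
  have fin: "finite E"
    using G by (intro finite_subset[of E "Pow V"]) (auto simp: simple_graph_def)
  have ab: "a \<noteq> b" using card2[OF e] by auto
  have loop: "{x} \<notin> E" for x using card2[of "{x}"] by auto
  have T: "?T \<subseteq> ?D a \<times> ?D b" by (auto simp: neighborhood_def)
  have cT: "card ?T = card ?C"
    by (rule card_image) (auto simp: inj_on_def doubleton_eq_iff)
  have "bij_betw (\<lambda>(p, q). {p, q} - {{a, b}}) (?D a \<times> ?D b - ?T) ?F"
  proof (rule bij_betwI')
    have pair: "(p = e \<or> p = p' \<or> p = q') \<and> (q = e \<or> q = p' \<or> q = q')"
      if "{p, q} - {e} \<subseteq> {p', q'} - {e}" for p q p' q' e :: "'a set"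
      using that by blast
    have only_b: "p = {a, b}" if "p \<in> ?D a" "b \<in> p" for p
      using edge[of p a b] that ab by blast
    have only_a: "p = {a, b}" if "p \<in> ?D b" "a \<in> p" for p
      using edge[of p a b] that ab by blast
    fix x y assume x: "x \<in> ?D a \<times> ?D b - ?T" and y: "y \<in> ?D a \<times> ?D b - ?T"
    obtain p q p' q' where [simp]: "x = (p, q)" "y = (p', q')" by (metis surj_pair)
    have pq: "p \<in> ?D a" "q \<in> ?D b" "p' \<in> ?D a" "q' \<in> ?D b" using x y by auto
    show "(case x of (p, q) \<Rightarrow> {p, q} - {{a, b}}) = (case y of (p, q) \<Rightarrow> {p, q} - {{a, b}}) \<longleftrightarrow> x = y"
    proof
      assume "(case x of (p, q) \<Rightarrow> {p, q} - {{a, b}}) = (case y of (p, q) \<Rightarrow> {p, q} - {{a, b}})"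
      then have eq: "{p, q} - {{a, b}} = {p', q'} - {{a, b}}" by simp
      have sub: "p = {a, b} \<or> p = p' \<or> p = q'" "q = {a, b} \<or> q = p' \<or> q = q'"
          "p' = {a, b} \<or> p' = p \<or> p' = q" "q' = {a, b} \<or> q' = p \<or> q' = q"
        using pair[OF equalityD1[OF eq]] pair[OF equalityD2[OF eq]] by blast+
      \<comment> \<open>If they differ, one of them is not \<open>{a, b}\<close> and reappears as
        the edge at \<open>b\<close> of the other pair. It then contains both \<open>a\<close> and
        \<open>b\<close>, a contradiction.\<close>
      have "p = p'"
      proof (rule ccontr)
        assume "p \<noteq> p'"
        then have "p = q' \<and> p \<noteq> {a, b} \<or> p' = q \<and> p' \<noteq> {a, b}" using sub by metis
        then show False using only_a[of q] only_a[of q'] pq by auto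
      qed
      moreover have "q = q'"
      proof (rule ccontr)
        assume "q \<noteq> q'"
        then have "q = p' \<and> q \<noteq> {a, b} \<or> q' = p \<and> q' \<noteq> {a, b}" using sub by metis
        then show False using only_b[of p] only_b[of p'] pq by auto
      qed
      ultimately show "x = y" by simp
    qed simp
  next
    fix x assume x: "x \<in> ?D a \<times> ?D b - ?T"
    obtain p q where [simp]: "x = (p, q)" by (metis surj_pair)
    have pq: "p \<in> E" "a \<in> p" "q \<in> E" "b \<in> q" "(p, q) \<notin> ?T" using x by auto
    \<comment> \<open>Under these assumptions the edges can only meet in a third vertex, a common
      neighbor, and \<open>?T\<close> excludes that.\<close>
    have disj: "p \<inter> q = {}" if "p \<noteq> {a, b}" "q \<noteq> {a, b}"
    proof (rule ccontr)
      assume "p \<inter> q \<noteq> {}"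
      then obtain z where z: "z \<in> p" "z \<in> q" by blast
      have "z \<noteq> a" using edge[of q a b] pq z ab that by blast
      moreover have "z \<noteq> b" using edge[of p a b] pq z ab that by blast
      ultimately have "p = {a, z}" "q = {b, z}" using edge[of p a z] edge[of q b z] pq z by blast+
      then show False using pq by (auto simp: neighborhood_def)
    qed
    have "matching E ({p, q} - {{a, b}})"
      using pq disj by (intro matchingI) auto
    moreover have "{p, q} - {{a, b}} \<subseteq> incident_edges E {a, b}"
      using pq by (auto simp: incident_edges_def)
    ultimately show "(case x of (p, q) \<Rightarrow> {p, q} - {{a, b}}) \<in> ?F" by simp
  next
    fix F assume "F \<in> ?F"
    then have F: "matching E F" "F \<subseteq> incident_edges E {a, b}" by auto
    have FE: "f \<in> E" "f \<noteq> {a, b}" "a \<in> f \<or> b \<in> f" if "f \<in> F" for f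
      using F(2) that by (auto simp: incident_edges_def)
    \<comment> \<open>The inverse map: the edge of \<open>F\<close> at \<open>x\<close>, with
      \<open>{a, b}\<close> as default when \<open>F\<close> leaves \<open>x\<close>
      uncovered.\<close>
    define pick where "pick x = (if \<exists>f\<in>F. x \<in> f then SOME f. f \<in> F \<and> x \<in> f else {a, b})" for x
    have pick: "pick x = f" if "f \<in> F" "x \<in> f" for x f
    proof -
      have "(SOME f. f \<in> F \<and> x \<in> f) \<in> F \<and> x \<in> (SOME f. f \<in> F \<and> x \<in> f)"
        by (rule someI) (use that in blast)
      then have "(SOME f. f \<in> F \<and> x \<in> f) = f"
        using matching_disjoint[OF F(1) _ that(1)] that(2) by blast
      then show ?thesis using that by (auto simp: pick_def)
    qed
    have pick': "pick x = {a, b}" if "\<not> (\<exists>f\<in>F. x \<in> f)" for x using that by (auto simp: pick_def)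
    have mem: "pick a \<in> ?D a" "pick b \<in> ?D b"
      using pick pick' FE(1) e by (metis (mono_tags, lifting) insertI1 insertI2 mem_Collect_eq)+
    have "(pick a, pick b) \<notin> ?T"
    proof
      assume "(pick a, pick b) \<in> ?T"
      then obtain z where z: "pick a = {a, z}" "pick b = {b, z}" "{a, z} \<in> E" "{b, z} \<in> E"
        by (auto simp: neighborhood_def)
      have zz: "z \<noteq> a" "z \<noteq> b" using z loop by auto
      then have "pick a \<noteq> {a, b}" "pick b \<noteq> {a, b}" using z ab by (auto simp: doubleton_eq_iff)
      then have "pick a \<in> F" "pick b \<in> F" using pick pick' by metis+
      then have "pick a = pick b" using matching_disjoint[OF F(1), of "pick a" "pick b"] z by blast
      then show False using z ab zz by (auto simp: doubleton_eq_iff)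
    qed
    moreover have "F = {pick a, pick b} - {{a, b}}"
    proof (intro equalityI subsetI)
      fix f assume "f \<in> F"
      then show "f \<in> {pick a, pick b} - {{a, b}}" using FE[of f] pick by blast
    next
      fix f assume "f \<in> {pick a, pick b} - {{a, b}}"
      then show "f \<in> F" using pick pick' by (metis Diff_iff insertE singletonD singletonI)
    qed
    ultimately show "\<exists>x\<in>?D a \<times> ?D b - ?T. F = (case x of (p, q) \<Rightarrow> {p, q} - {{a, b}})"
      using mem by (intro bexI[of _ "(pick a, pick b)"]) auto
  qed
  then have "card ?F = card (?D a \<times> ?D b - ?T)" by (simp add: bij_betw_same_card)
  also have "\<dots> = card (?D a \<times> ?D b) - card ?T"
    using T fin by (intro card_Diff_subset) (auto intro: finite_subset[OF T])
  finally have "card ?F = vdegree E a * vdegree E b - card ?C"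
    by (simp only: cT vdegree_def card_cartesian_product)
  \<comment> \<open>This bound rules out truncation in the subtraction of natural numbers.\<close>
  moreover have "card ?C \<le> vdegree E a * vdegree E b"
    using card_mono[OF _ T] fin by (simp add: cT vdegree_def card_cartesian_product)
  ultimately show ?thesis by (simp add: of_nat_diff)
qed

section \<open>Summation over the edges of the matching\<close>

theorem theorem2p6:
  fixes V :: "'a::finite set" and E M :: "'a set set" and u v :: "nat \<Rightarrow> 'a" and s :: nat
  assumes "simple_graph V E"
    and "M = (\<lambda>i. {u i, v i}) ` {1..s}"
    and "inj_on (\<lambda>i. {u i, v i}) {1..s}"
    and "matching_without_common_neighbors E M"
  shows "int (matching_degree E M) =
    int (card {e \<in> E. e \<inter> (u ` {1..s} \<union> v ` {1..s}) = {}}) +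
    (\<Sum>i=1..s. int (vdegree E (u i)) * int (vdegree E (v i)) -
               int (card (neighborhood E (u i) \<inter> neighborhood E (v i))))"
proof -
  let ?K = "{g \<in> E. g \<inter> \<Union>M = {}}"
  let ?F = "\<lambda>e. {F. matching E F \<and> F \<subseteq> incident_edges E e}"
  let ?A = "(\<lambda>g. insert g M) ` ?K"
  let ?B = "\<lambda>e. (\<lambda>F. (M - {e}) \<union> F) ` ?F e"
  have M: "matching E M" using assms(4) by (simp add: matching_without_common_neighbors_def)
  have ne: "{} \<notin> E" using assms(1) by (auto simp: simple_graph_def)
  have FM: "F \<inter> M = {}" if "e \<in> M" "F \<in> ?F e" for e F
  proof -
    have "f \<notin> M" if "f \<in> F" for f
    proof -
      have "f \<in> incident_edges E e" using that \<open>F \<in> ?F e\<close> by blast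
      moreover from this have "f \<inter> e \<noteq> {}" by (simp add: incident_edges_def)
      ultimately show ?thesis
        using incident_edge_meets_one[OF assms(4) \<open>e \<in> M\<close> \<open>e \<in> M\<close>] by blast
    qed
    then show ?thesis by blast
  qed
  \<comment> \<open>The replacing edges avoid \<open>M\<close>, so \<open>N\<close> determines the
    deleted edge. Hence the sets \<open>?B e\<close> are disjoint from each other and from
    \<open>?A\<close>, whose members delete nothing.\<close>
  have diff: "M - N = {e}" if "e \<in> M" "N \<in> ?B e" for e N
    using that FM[OF that(1)] by blast
  have "matching_degree E M = card (?A \<union> (\<Union>e\<in>M. ?B e))"
    using matching_degree_eq_card[OF M] swap_prime_neighbors_eq[OF assms(4) ne] by simp
  also have "\<dots> = card ?A + card (\<Union>e\<in>M. ?B e)"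
  proof (rule card_Un_disjoint)
    show "?A \<inter> (\<Union>e\<in>M. ?B e) = {}"
    proof (rule Int_emptyI)
      fix N assume "N \<in> ?A" "N \<in> (\<Union>e\<in>M. ?B e)"
      then obtain e where "e \<in> M" "N \<in> ?B e" by (elim UN_E)
      then have "M - N = {e}" by (rule diff)
      moreover have "M \<subseteq> N" using \<open>N \<in> ?A\<close> by auto
      ultimately show False by blast
    qed
  qed (intro ballI finite)+
  also have "card ?A = card ?K"
  proof (rule card_image, rule inj_onI)
    fix g h assume "g \<in> ?K" "h \<in> ?K" "insert g M = insert h M"
    moreover have "g \<notin> M"
    proof
      assume "g \<in> M"
      then have "g = {}" using \<open>g \<in> ?K\<close> by auto
      then show False using \<open>g \<in> ?K\<close> ne by simp
    qed
    ultimately show "g = h" by blast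
  qed
  also have "card (\<Union>e\<in>M. ?B e) = (\<Sum>e\<in>M. card (?B e))"
  proof (rule card_UN_disjoint)
    show "\<forall>e\<in>M. \<forall>f\<in>M. e \<noteq> f \<longrightarrow> ?B e \<inter> ?B f = {}"
    proof (intro ballI impI Int_emptyI)
      fix e f N assume "e \<in> M" "f \<in> M" "e \<noteq> f" and N: "N \<in> ?B e" "N \<in> ?B f"
      then show False using diff[OF \<open>e \<in> M\<close> N(1)] diff[OF \<open>f \<in> M\<close> N(2)] by simp
    qed
  qed (intro ballI finite)+
  also have "(\<Sum>e\<in>M. card (?B e)) = (\<Sum>e\<in>M. card (?F e))"
  proof (intro sum.cong refl card_image inj_onI)
    fix e F F' assume "e \<in> M" "F \<in> ?F e" "F' \<in> ?F e" "M - {e} \<union> F = M - {e} \<union> F'"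
    then show "F = F'" using FM[of e F] FM[of e F'] by blast
  qed
  also have "(\<Sum>e\<in>M. card (?F e)) = (\<Sum>i=1..s. card (?F {u i, v i}))"
    unfolding assms(2) by (simp only: sum.reindex[OF assms(3)] o_def)
  finally have "int (matching_degree E M) = int (card ?K) + (\<Sum>i=1..s. int (card (?F {u i, v i})))"
    by simp
  also have "(\<Sum>i=1..s. int (card (?F {u i, v i}))) =
    (\<Sum>i=1..s. int (vdegree E (u i)) * int (vdegree E (v i)) -
               int (card (neighborhood E (u i) \<inter> neighborhood E (v i))))"
  proof (intro sum.cong refl card_incident_matchings[OF assms(1)])
    fix i assume "i \<in> {1..s}"
    then show "{u i, v i} \<in> E" using M assms(2) by (auto simp: matching_def)
  qed
  also have "\<Union>M = u ` {1..s} \<union> v ` {1..s}" unfolding assms(2) by auto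
  finally show ?thesis .
qed

end
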